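(* Let $0<q<1$ and $a>0$. For $m=0,1,2,\dots$ put $\mu(m):=q^{-m}-a\,q^{m}$, and for $n=0,1,2,\dots$ let $d_n(\mu(m);a;q)$ be the polynomial of degree $n$ in $\mu(m)$ defined by $$d_n(\mu(m);a;q):={}_3\phi_0\bigl(q^{-m},-a\,q^{m},q^{-n};\,-\,;\,q,-q^n/a\bigr).$$ Then the polynomials $d_n$ are orthogonal on the set of points $\mu(m)$, $m=0,1,2,\dots$, and the orthogonality relation is $$\sum_{m=0}^\infty \frac{(1+aq^{2m})\,a^m}{(-aq^m;q)_\infty\,(q;q)_m}\,q^{m(3m-1)/2}\,d_n(\mu(m);a;q)\,d_{n'}(\mu(m);a;q)=\frac{(q;q)_n}{a^n q^{n(n+1)/2}}\,\delta_{nn'}$$ for all integers $n,n'\ge 0$.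
   Context: Notation: $(x;q)_k=\prod_{j=0}^{k-1}(1-xq^j)$ and $(x;q)_\infty=\prod_{j=0}^{\infty}(1-xq^j)$; $\delta_{nn'}$ is the Kronecker delta. The basic hypergeometric function is $${}_3\phi_0(x_1,x_2,x_3;\,-\,;\,q,z)=\sum_{k\ge 0}\frac{(x_1;q)_k(x_2;q)_k(x_3;q)_k}{(q;q)_k}\,\bigl[(-1)^kq^{k(k-1)/2}\bigr]^{-2}z^k,$$ which here is a finite sum since $(q^{-n};q)_k=0$ for $k>n$. Since $(q^{-m};q)_k(-aq^m;q)_k=\prod_{j=0}^{k-1}\bigl(1-aq^{2j}-q^j\mu(m)\bigr)$, the function $d_n$ is indeed a polynomial of degree $n$ in $\mu(m)$. The polynomials $d_n(\mu(m);a;q)$ are called dual alternative $q$-Charlier polynomials. *)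

theory Defs
  imports "HOL-Analysis.Analysis" "HOL-Computational_Algebra.Polynomial"
begin

definition qpoch :: "real \<Rightarrow> real \<Rightarrow> nat \<Rightarrow> real" where
  "qpoch x q k = (\<Prod>j<k. 1 - x * q ^ j)"

definition qpoch_inf :: "real \<Rightarrow> real \<Rightarrow> real" where
  "qpoch_inf x q = (\<Prod>j. 1 - x * q ^ j)"

(* In the exponents below and in the theorem, "div 2" on nat is exact, since the products
   k (k - 1), m (3 m - 1) and n (n + 1) are even (and the first two are 0 at argument 0). *)

definition phi_3_0 :: "real \<Rightarrow> real \<Rightarrow> real \<Rightarrow> real \<Rightarrow> real \<Rightarrow> real" where
  "phi_3_0 x1 x2 x3 q z =
     (\<Sum>k. qpoch x1 q k * qpoch x2 q k * qpoch x3 q k / qpoch q q k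
          * ((-1) ^ k * q ^ (k * (k - 1) div 2)) powi (-2) * z ^ k)"

definition mu :: "real \<Rightarrow> real \<Rightarrow> nat \<Rightarrow> real" where
  "mu a q m = q powi (- int m) - a * q ^ m"

(* dual_alt_qCharlier a q n m is the value d_n(mu(m); a; q) at the point mu(m), as in the
   defining formula; that it is the value of a polynomial of degree n at mu(m) is not built
   into the definition. *)
definition dual_alt_qCharlier :: "real \<Rightarrow> real \<Rightarrow> nat \<Rightarrow> nat \<Rightarrow> real" where
  "dual_alt_qCharlier a q n m =
     phi_3_0 (q powi (- int m)) (- a * q ^ m) (q powi (- int n)) q (- (q ^ n) / a)"

end

theory Submission
  imports Defs
begin

text \<open>
  Put \<open>e\<^sub>k(m) = (q\<^sup>-\<^sup>m;q)\<^sub>k (-a q\<^sup>m;q)\<^sub>k\<close> and let \<open>w\<^sub>a(m)\<close> be the weight. A telescoping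
  argument shows that the total mass is unchanged when \<open>a\<close> is replaced by \<open>a q\<close>; letting the parameter
  tend to \<open>0\<close> gives total mass \<open>1\<close>. Since \<open>w\<^sub>a(m+1) e\<^sub>k\<^sub>+\<^sub>1(m+1)\<close> is \<open>-a\<close> times \<open>w(m) e\<^sub>k(m)\<close> for the
  parameter \<open>a q\<^sup>2\<close>, the moments \<open>\<Sum> w e\<^sub>k\<close> are explicit, and a \<open>q\<close>-binomial sum shows
  \<open>\<Sum> w d\<^sub>n = 0\<close> for \<open>n > 0\<close>. Finally
  \<open>\<mu> d\<^sub>n = -a d\<^sub>n\<^sub>+\<^sub>1 + q\<^sup>-\<^sup>n d\<^sub>n + (1 - q\<^sup>-\<^sup>n) d\<^sub>n\<^sub>-\<^sub>1\<close>; applying this to \<open>d\<^sub>n\<close> and to \<open>d\<^sub>k\<close> in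
  \<open>\<Sum> w \<mu> d\<^sub>k d\<^sub>n\<close> reduces orthogonality for \<open>k + 1\<close> to that for \<open>k\<close> and \<open>k - 1\<close>.
\<close>

section \<open>Finite and infinite q-shifted factorials\<close>

lemma qpoch_0 [simp]: "qpoch x q 0 = 1"
  by (simp add: qpoch_def)

lemma qpoch_Suc: "qpoch x q (Suc k) = qpoch x q k * (1 - x * q ^ k)"
  by (simp add: qpoch_def)

lemma qpoch_Suc_shift: "qpoch x q (Suc k) = (1 - x) * qpoch (x * q) q k"
  unfolding qpoch_def by (subst prod.lessThan_Suc_shift) (simp add: mult_ac)

lemma qpoch_q_pos:
  assumes "0 < q" "q < 1"
  shows "0 < qpoch q q k"
  using assms unfolding qpoch_def
  by (intro prod_pos) (simp add: power_Suc_less_one flip: power_Suc)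

lemma convergent_prod_qpoch_inf:
  fixes q x :: real
  assumes "0 < q" "q < 1" "0 < x"
  shows "convergent_prod (\<lambda>j. 1 - - x * q ^ j)"
proof -
  have "summable (\<lambda>j. x * q ^ j)"
    by (rule summable_mult[OF summable_geometric]) (use assms in simp)
  moreover have "x * q ^ j \<noteq> - 1" for j
    using mult_pos_pos[OF assms(3) zero_less_power[OF assms(1), of j]] by linarith
  ultimately have "convergent_prod (\<lambda>j. 1 + x * q ^ j)"
    using assms by (intro summable_imp_convergent_prod_real) (simp_all add: abs_mult)
  then show ?thesis by simp
qed

lemma qpoch_inf_split:
  assumes "0 < q" "q < 1" "0 < x"
  shows "qpoch_inf (- x) q = qpoch (- x) q n * qpoch_inf (- (x * q ^ n)) q"
proof -
  have nz: "1 - - x * q ^ j \<noteq> 0" for j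
    using mult_pos_pos[OF assms(3) zero_less_power[OF assms(1), of j]] by simp
  show ?thesis
    unfolding qpoch_inf_def qpoch_def
    using prodinf_split_initial_segment[OF convergent_prod_qpoch_inf[OF assms], of n] nz
    by (simp add: power_add mult_ac)
qed

text \<open>All factors are at least 1, so the empty partial product is a lower bound. This bounds
  the denominators of the weight from below.\<close>

lemma qpoch_inf_ge_1:
  assumes "0 < q" "q < 1" "0 < x"
  shows "1 \<le> qpoch_inf (- x) q"
proof -
  have "(\<Prod>j<0. 1 - - x * q ^ j) \<le> qpoch_inf (- x) q"
    unfolding qpoch_inf_def
    using convergent_prod_has_prod[OF convergent_prod_qpoch_inf[OF assms]]
    by (rule prod_le_prodinf) (use assms in auto)
  then show ?thesis by simp
qed

text \<open>The tail is the full product divided by its first n factors, and these tend to the full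
  product, which is nonzero.\<close>

lemma qpoch_inf_tendsto_1:
  assumes "0 < q" "q < 1" "0 < x"
  shows "(\<lambda>n. qpoch_inf (- (x * q ^ n)) q) \<longlonglongrightarrow> 1"
proof -
  let ?P = "qpoch_inf (- x) q"
  have P: "?P \<noteq> 0" using qpoch_inf_ge_1[OF assms] by linarith
  have "(\<lambda>n. qpoch (- x) q (Suc n)) \<longlonglongrightarrow> ?P"
    using convergent_prod_LIMSEQ[OF convergent_prod_qpoch_inf[OF assms]]
    by (simp add: qpoch_def qpoch_inf_def lessThan_Suc_atMost)
  then have "(\<lambda>n. qpoch (- x) q n) \<longlonglongrightarrow> ?P"
    by (subst (asm) filterlim_sequentially_Suc)
  then have "(\<lambda>n. ?P / qpoch (- x) q n) \<longlonglongrightarrow> ?P / ?P"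
    using P by (intro tendsto_intros)
  moreover have "?P / qpoch (- x) q n = qpoch_inf (- (x * q ^ n)) q" for n
    using qpoch_inf_split[OF assms, of n] P by (auto simp: field_simps)
  ultimately show ?thesis using P by simp
qed

section \<open>The weight: summability and total mass\<close>

definition pent :: "nat \<Rightarrow> nat" where
  "pent m = m * (3 * m - 1) div 2"

lemma pent_0 [simp]: "pent 0 = 0"
  by (simp add: pent_def)

lemma pent_Suc: "pent (Suc m) = pent m + 3 * m + 1"
proof -
  \<comment> \<open>The increment is an explicit multiple of 2, so \<open>div 2\<close> splits over
    the sum without a parity argument. The case m = 0 is separate because of the truncated
    subtraction.\<close>
  have "Suc m * (3 * Suc m - 1) = m * (3 * m - 1) + (3 * m + 1) * 2"
    by (cases m) (simp_all add: algebra_simps)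
  then show ?thesis by (simp add: pent_def)
qed

definition weight :: "real \<Rightarrow> real \<Rightarrow> nat \<Rightarrow> real" where
  "weight a q m = (1 + a * q ^ (2 * m)) * a ^ m / (qpoch_inf (- a * q ^ m) q * qpoch q q m) * q ^ pent m"

text \<open>The weight without 1 + a q^(2m), which is at most 1 + a, and without the infinite
  product, which is at least 1.\<close>

definition majorant :: "real \<Rightarrow> real \<Rightarrow> nat \<Rightarrow> real" where
  "majorant a q m = a ^ m * q ^ pent m / qpoch q q m"

text \<open>Consecutive terms have ratio a q^(3m+1) / (1 - q^(m+1)), which is at most a q^m / (1 -
  q) and hence eventually below 1/2.\<close>

lemma summable_majorant:
  assumes "0 < q" "q < 1" "0 < a"
  shows "summable (majorant a q)"
proof -
  have "(\<lambda>m. a / (1 - q) * q ^ m) \<longlonglongrightarrow> a / (1 - q) * 0"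
    using assms by (intro tendsto_intros) auto
  then have "eventually (\<lambda>m. a / (1 - q) * q ^ m < 1 / 2) sequentially"
    by (rule order_tendstoD) simp
  then obtain N where N: "\<And>m. m \<ge> N \<Longrightarrow> a / (1 - q) * q ^ m < 1 / 2"
    by (auto simp: eventually_sequentially)
  show ?thesis
  proof (rule summable_ratio_test[of "1/2" N])
    fix m assume m: "m \<ge> N"
    have pos: "0 < majorant a q m"
      using assms qpoch_q_pos[of q m] by (simp add: majorant_def)
    have pos': "0 < majorant a q (Suc m)"
      using assms qpoch_q_pos[of q "Suc m"] by (simp add: majorant_def)
    have q1: "q * q ^ m \<le> q" using assms by (simp add: power_le_one mult_left_le)
    have "majorant a q (Suc m) = a * q ^ (3 * m + 1) / (1 - q * q ^ m) * majorant a q m"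
      by (simp add: majorant_def qpoch_Suc pent_Suc power_add mult_ac)
    also have "\<dots> \<le> a * q ^ m / (1 - q) * majorant a q m"
      using assms pos q1
      by (intro mult_right_mono frac_le mult_left_mono power_decreasing) auto
    also have "\<dots> \<le> 1 / 2 * majorant a q m"
      using N[OF m] pos by (intro mult_right_mono) auto
    finally show "norm (majorant a q (Suc m)) \<le> 1 / 2 * norm (majorant a q m)"
      using pos pos' by simp
  qed simp
qed

lemma weight_nonneg:
  assumes "0 < q" "q < 1" "0 < a"
  shows "0 \<le> weight a q m"
  using assms qpoch_q_pos[of q m] qpoch_inf_ge_1[of q "a * q ^ m"]
  by (auto simp: weight_def intro!: mult_nonneg_nonneg divide_nonneg_nonneg)

lemma weight_le_majorant:
  assumes "0 < q" "q < 1" "0 < a"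
  shows "weight a q m \<le> (1 + a) * majorant a q m"
proof -
  have "1 + a * q ^ (2 * m) \<le> 1 + a" "1 \<le> qpoch_inf (- (a * q ^ m)) q"
    using assms qpoch_inf_ge_1[of q "a * q ^ m"] by (auto simp: power_le_one mult_left_le)
  then have "(1 + a * q ^ (2 * m)) / qpoch_inf (- (a * q ^ m)) q \<le> (1 + a) / 1"
    using assms by (intro frac_le) auto
  then have "(1 + a * q ^ (2 * m)) / qpoch_inf (- (a * q ^ m)) q * majorant a q m
      \<le> (1 + a) * majorant a q m"
    using assms qpoch_q_pos[of q m] by (intro mult_right_mono) (auto simp: majorant_def)
  then show ?thesis by (simp add: weight_def majorant_def)
qed

lemma summable_weight:
  assumes "0 < q" "q < 1" "0 < a"
  shows "summable (weight a q)"
  by (rule summable_comparison_test'[where g = "\<lambda>m. (1 + a) * majorant a q m"])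
     (use assms weight_nonneg weight_le_majorant in \<open>auto intro: summable_mult summable_majorant\<close>)

text \<open>The telescoping comes from \<open>1 + a q\<^sup>2\<^sup>m = (1 - q\<^sup>m) + q\<^sup>m (1 + a q\<^sup>m)\<close>.\<close>

lemma weight_telescope:
  fixes a q :: real
  assumes "0 < q" "q < 1" "0 < a"
  defines "u \<equiv> \<lambda>m. (1 - q ^ m) * a ^ m * q ^ pent m / (qpoch_inf (- (a * q ^ m)) q * qpoch q q m)"
  shows "weight a q m - weight (a * q) q m = u m - u (Suc m)"
proof -
  \<comment> \<open>\<open>X\<close> is the infinite product left after splitting off 1 + a q^m. It
    also occurs in the weight for a q at m and in \<open>u\<close> at m + 1, so all four terms are
    multiples of \<open>G\<close>.\<close>
  define X where "X = qpoch_inf (- (a * q ^ Suc m)) q"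
  have X: "X > 0"
    using qpoch_inf_ge_1[of q "a * q ^ Suc m"] assms by (simp add: X_def)
  define G where "G = a ^ m * q ^ pent m / (X * qpoch q q m)"
  have head: "qpoch_inf (- (a * q ^ m)) q = (1 + a * q ^ m) * X"
    using qpoch_inf_split[of q "a * q ^ m" 1] assms by (simp add: X_def qpoch_Suc mult_ac)
  have pos: "1 + a * q ^ m > 0" using assms by (simp add: add_pos_pos)
  have nz: "1 - q * q ^ m \<noteq> 0" using power_Suc_less_one[OF assms(1,2), of m] by simp
  have "weight a q m = (1 + a * (q ^ m)\<^sup>2) * G / (1 + a * q ^ m)"
    by (simp add: weight_def G_def head mult_ac flip: power_mult)
  moreover have "weight (a * q) q m = (1 + a * q * (q ^ m)\<^sup>2) * q ^ m * G"
    by (simp add: weight_def G_def X_def power_mult_distrib mult_ac flip: power_mult)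
  moreover have "u m = (1 - q ^ m) * G / (1 + a * q ^ m)"
    by (simp add: u_def G_def head mult_ac)
  moreover have "u (Suc m) = a * q * (q ^ m)^3 * G"
  proof -
    have "u (Suc m) = (1 - q * q ^ m) * (a * a ^ m * (q ^ pent m * (q * q ^ (3 * m)))) /
        ((1 - q * q ^ m) * (X * qpoch q q m))"
      by (simp add: u_def X_def qpoch_Suc pent_Suc power_add mult_ac)
    also have "\<dots> = a * a ^ m * (q ^ pent m * (q * q ^ (3 * m))) / (X * qpoch q q m)"
      by (rule mult_divide_mult_cancel_left[OF nz])
    finally show ?thesis
      by (simp add: G_def power_mult[of q m 3] mult.commute[of m 3, symmetric] mult_ac)
  qed
  moreover have "(1 + a * (q ^ m)\<^sup>2) * G / (1 + a * q ^ m) - (1 - q ^ m) * G / (1 + a * q ^ m) = q ^ m * G"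
  proof -
    have "(1 + a * (q ^ m)\<^sup>2) * G - (1 - q ^ m) * G = q ^ m * G * (1 + a * q ^ m)"
      by algebra
    then show ?thesis
      using pos by (simp flip: diff_divide_distrib)
  qed
  ultimately show ?thesis
    by (simp add: algebra_simps power2_eq_square power3_eq_cube)
qed

text \<open>The telescoped series sums to \<open>u 0\<close> minus the limit of \<open>u\<close>.
  The first is 0 through the factor 1 - q^0, the second because \<open>majorant\<close> dominates
  \<open>u\<close>.\<close>

lemma suminf_weight_step:
  assumes "0 < q" "q < 1" "0 < a"
  shows "suminf (weight (a * q) q) = suminf (weight a q)"
proof -
  define u where "u m = (1 - q ^ m) * a ^ m * q ^ pent m / (qpoch_inf (- (a * q ^ m)) q * qpoch q q m)" for m
  have "norm (u m) \<le> majorant a q m" for m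
  proof -
    have "(1 - q ^ m) / qpoch_inf (- (a * q ^ m)) q \<le> 1 / 1"
      using assms qpoch_inf_ge_1[of q "a * q ^ m"] by (intro frac_le) (auto simp: power_le_one)
    moreover have "0 \<le> (1 - q ^ m) / qpoch_inf (- (a * q ^ m)) q"
      using assms qpoch_inf_ge_1[of q "a * q ^ m"] by (intro divide_nonneg_nonneg) (auto simp: power_le_one)
    moreover have "u m = (1 - q ^ m) / qpoch_inf (- (a * q ^ m)) q * majorant a q m"
      by (simp add: u_def majorant_def)
    moreover have "0 \<le> majorant a q m"
      using assms qpoch_q_pos[of q m] by (simp add: majorant_def)
    ultimately show ?thesis
      by (simp only: real_norm_def abs_mult abs_of_nonneg mult_left_le_one_le div_by_1)
  qed
  then have "u \<longlonglongrightarrow> 0"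
    using summable_LIMSEQ_zero[OF summable_majorant[OF assms]]
    by (intro Lim_null_comparison[of u "majorant a q"]) auto
  then have "(\<lambda>m. u m - u (Suc m)) sums (u 0 - 0)"
    by (rule telescope_sums')
  then have "(\<lambda>m. weight a q m - weight (a * q) q m) sums 0"
    using weight_telescope[OF assms] by (simp add: u_def)
  moreover have "(\<lambda>m. weight a q m - weight (a * q) q m) sums (suminf (weight a q) - suminf (weight (a * q) q))"
    using assms by (intro sums_diff summable_sums summable_weight) auto
  ultimately show ?thesis using sums_unique2 by fastforce
qed

text \<open>The mass is the same for every parameter a q^n. As n grows, the terms with m > 0
  contribute O(q^n) in total, while the term m = 0 tends to 1.\<close>

lemma weight_sums_1:
  assumes "0 < q" "q < 1" "0 < a"
  shows "weight a q sums 1"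
proof -
  let ?S = "suminf (weight a q)"
  have S: "suminf (weight (a * q ^ n) q) = ?S" for n
  proof (induction n)
    case (Suc n)
    then show ?case
      using suminf_weight_step[of q "a * q ^ n"] assms by (simp add: mult_ac)
  qed simp
  define C where "C = (1 + a) * suminf (majorant a q)"
  have bound: "norm (?S - weight (a * q ^ n) q 0) \<le> C * q ^ n" for n
  proof -
    let ?b = "a * q ^ n"
    have b: "0 < ?b" "?b \<le> a" using assms by (auto simp: power_le_one mult_left_le)
    have sm: "summable (\<lambda>m. weight ?b q (Suc m))"
      using summable_weight[OF assms(1,2) b(1)] by (subst summable_Suc_iff)
    have nonneg: "0 \<le> majorant a q m" for m
      using assms qpoch_q_pos[of q m] by (simp add: majorant_def)
    have le: "weight ?b q (Suc m) \<le> (1 + a) * q ^ n * majorant a q (Suc m)" for m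
    proof -
      have "weight ?b q (Suc m) \<le> (1 + ?b) * majorant ?b q (Suc m)"
        using assms b by (intro weight_le_majorant)
      \<comment> \<open>Since m + 1 is positive, the power of q^n gained here is at most q^n itself;
        this gives the rate in \<open>bound\<close>.\<close>
      also have "majorant ?b q (Suc m) = (q ^ n) ^ Suc m * majorant a q (Suc m)"
        by (simp add: majorant_def power_mult_distrib del: power_Suc)
      also have "(1 + ?b) * \<dots> \<le> (1 + a) * (q ^ n * majorant a q (Suc m))"
      proof (intro mult_mono)
        have "q ^ n * (q ^ n) ^ m \<le> q ^ n"
          using assms by (intro mult_left_le) (auto simp: power_le_one)
        then show "(q ^ n) ^ Suc m \<le> q ^ n" by simp
      qed (use assms b nonneg in auto)
      finally show ?thesis by (simp add: mult_ac)
    qed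
    have smM: "summable (\<lambda>m. majorant a q (Suc m))"
      using summable_majorant[OF assms] by (subst summable_Suc_iff)
    have eq: "?S - weight ?b q 0 = (\<Sum>m. weight ?b q (Suc m))"
      using suminf_split_head[OF summable_weight[OF assms(1,2) b(1)]] S by simp
    have "(\<Sum>m. weight ?b q (Suc m)) \<le> (\<Sum>m. (1 + a) * q ^ n * majorant a q (Suc m))"
      using sm smM by (intro suminf_le le summable_mult)
    also have "\<dots> = (1 + a) * q ^ n * (\<Sum>m. majorant a q (Suc m))"
      by (rule suminf_mult[OF smM])
    also have "\<dots> \<le> (1 + a) * q ^ n * suminf (majorant a q)"
      using suminf_split_head[OF summable_majorant[OF assms]] nonneg[of 0] assms
      by (intro mult_left_mono) simp_all
    also have "\<dots> = C * q ^ n"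
      by (simp add: C_def)
    finally have "(\<Sum>m. weight ?b q (Suc m)) \<le> C * q ^ n" .
    moreover have "0 \<le> (\<Sum>m. weight ?b q (Suc m))"
      using sm assms b by (intro suminf_nonneg weight_nonneg)
    ultimately show ?thesis by (simp add: eq)
  qed
  have "(\<lambda>n. C * q ^ n) \<longlonglongrightarrow> C * 0"
    using assms by (intro tendsto_intros) auto
  then have "(\<lambda>n. C * q ^ n) \<longlonglongrightarrow> 0"
    by simp
  with always_eventually have lim0: "(\<lambda>n. ?S - weight (a * q ^ n) q 0) \<longlonglongrightarrow> 0"
    by (rule Lim_null_comparison) (use bound in blast)
  have "(\<lambda>n. a * q ^ n) \<longlonglongrightarrow> a * 0"
    using assms by (intro tendsto_intros) auto
  then have "(\<lambda>n. ?S - (1 + a * q ^ n) / qpoch_inf (- (a * q ^ n)) q) \<longlonglongrightarrow> ?S - (1 + a * 0) / 1"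
    by (intro tendsto_diff tendsto_divide tendsto_add tendsto_const qpoch_inf_tendsto_1 assms) simp_all
  then have "(\<lambda>n. ?S - weight (a * q ^ n) q 0) \<longlonglongrightarrow> ?S - 1"
    by (simp add: weight_def)
  then have "?S - 1 = 0"
    using lim0 by (rule LIMSEQ_unique)
  then show ?thesis
    using summable_sums[OF summable_weight[OF assms]] by simp
qed

section \<open>The basis e_k and its moments\<close>

definition basis :: "real \<Rightarrow> real \<Rightarrow> nat \<Rightarrow> nat \<Rightarrow> real" where
  "basis a q k m = qpoch (q powi (- int m)) q k * qpoch (- a * q ^ m) q k"

lemma basis_0 [simp]: "basis a q 0 m = 1"
  by (simp add: basis_def)

text \<open>In (1 - q^(k-m)) (1 + a q^(k+m)) the terms depending on m combine to -q^k mu(m). Hence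
  \<open>basis\<close> is a product of k linear factors in mu(m).\<close>

lemma basis_Suc:
  assumes "q \<noteq> 0"
  shows "basis a q (Suc k) m = basis a q k m * (1 - a * q ^ (2 * k) - q ^ k * mu a q m)"
proof -
  have "(1 - q powi (- int m) * q ^ k) * (1 - - a * q ^ m * q ^ k) = 1 - a * q ^ (2 * k) - q ^ k * mu a q m"
    using assms by (simp add: mu_def power_int_minus field_simps power_mult[of q k 2] power2_eq_square flip: mult_2_right)
  then show ?thesis
    by (simp only: basis_def qpoch_Suc mult_ac)
qed

text \<open>Once the first factors 1 - q^(-(m+1)) and 1 + a q^(m+1) are split off, the rest of the
  basis at m + 1 is the basis for a q^2 at m. The split factors cancel against the denominator of
  the weight up to the constant -a.\<close>

lemma weight_basis_Suc:
  fixes a q :: real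
  assumes "0 < q" "q < 1" "0 < a"
  shows "weight a q (Suc m) * basis a q (Suc k) (Suc m) = - a * (weight (a * q\<^sup>2) q m * basis (a * q\<^sup>2) q k m)"
proof -
  define X where "X = qpoch_inf (- (a * q ^ (m + 2))) q"
  define G where "G = (1 + a * q ^ (2 * m + 2)) * a ^ m * q ^ pent m * q ^ (2 * m) / (X * qpoch q q m)"
  define B where "B = basis (a * q\<^sup>2) q k m"
  have X: "X > 0"
    using qpoch_inf_ge_1[of q "a * q ^ (m + 2)"] assms by (simp add: X_def)
  have head: "qpoch_inf (- (a * q ^ Suc m)) q = (1 + a * q ^ Suc m) * X"
    using qpoch_inf_split[of q "a * q ^ Suc m" 1] assms by (simp add: X_def qpoch_Suc mult_ac)
  have pos: "1 + a * q ^ Suc m > 0" using assms by (simp add: add_pos_pos)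
  have nz: "1 - q * q ^ m > 0" using power_Suc_less_one[OF assms(1,2), of m] by simp
  have G: "weight (a * q\<^sup>2) q m = G"
  proof -
    have g1: "a * q\<^sup>2 * q ^ (2 * m) = a * q ^ (2 * m + 2)"
      by (simp only: power_add mult_ac)
    have g2: "- (a * q\<^sup>2) * q ^ m = - (a * q ^ (m + 2))"
      by (simp only: power_add mult_ac mult_minus_left mult_minus_right)
    have g3: "(a * q\<^sup>2) ^ m = a ^ m * q ^ (2 * m)"
      by (simp only: power_mult_distrib power_mult)
    show ?thesis
      unfolding weight_def G_def X_def g1 g2 g3
      by (simp only: times_divide_eq_left times_divide_eq_right mult_ac)
  qed
  have W: "weight a q (Suc m) = a * q ^ Suc m / ((1 - q ^ Suc m) * (1 + a * q ^ Suc m)) * G"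
  proof -
    have "weight a q (Suc m) = (1 + a * q ^ (2 * m + 2)) * (a * a ^ m) * (q ^ pent m * q ^ (2 * m) * q ^ Suc m)
        / ((1 + a * q ^ Suc m) * X * (qpoch q q m * (1 - q ^ Suc m)))"
      unfolding weight_def mult_minus_left head qpoch_Suc pent_Suc
      by (simp add: power_add mult_ac flip: power_mult) (simp add: eval_nat_numeral power_add mult_ac)
    then show ?thesis by (simp add: G_def mult_ac)
  qed
  have B: "basis a q (Suc k) (Suc m) = (1 - 1 / q ^ Suc m) * (1 + a * q ^ Suc m) * B"
  proof -
    have e1: "q powi (- int (Suc m)) * q = q powi (- int m)"
      unfolding power_int_minus power_int_of_nat using assms by simp
    have e2: "- a * q ^ Suc m * q = - (a * q\<^sup>2) * q ^ m"
      by (simp add: power2_eq_square)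
    have e3: "q powi (- int (Suc m)) = 1 / q ^ Suc m"
      unfolding power_int_minus power_int_of_nat by (rule inverse_eq_divide)
    show ?thesis
      unfolding basis_def B_def qpoch_Suc_shift e1 e2 unfolding e3
      by (simp only: mult_minus_left diff_minus_eq_add mult_ac)
  qed
  \<comment> \<open>Applied with z = q^(m+1), D = 1 - z and E = 1 + a z.\<close>
  have cancel: "a * z / (D * E) * G * ((1 - 1 / z) * E * B) = - a * (G * B)"
    if "D = 1 - z" "D \<noteq> 0" "E \<noteq> 0" "z \<noteq> 0" for z D E
  proof -
    have "z * (1 - 1 / z) = - D"
      using that by (simp add: right_diff_distrib)
    then have "a * z * (1 - 1 / z) / D = - a"
      using that(2) by (simp add: mult.assoc)
    moreover have "a * z / (D * E) * G * ((1 - 1 / z) * E * B) = a * z * (1 - 1 / z) / D * (G * B)"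
      using that(3) by simp
    ultimately show ?thesis by (simp only:)
  qed
  show ?thesis
    unfolding W B G B_def[symmetric]
    by (rule cancel) (use pos nz assms in simp_all)
qed

text \<open>The parameter is generalized in the induction because each step passes from a to a
  q^2.\<close>

lemma moment_basis:
  fixes a q :: real
  assumes "0 < q" "q < 1" "0 < a"
  shows "(\<lambda>m. weight a q m * basis a q k m) sums ((- a) ^ k * q ^ (k * (k - 1)))"
  using assms(3)
proof (induction k arbitrary: a)
  case 0
  then show ?case using weight_sums_1[OF assms(1,2)] by simp
next
  case (Suc k)
  have "(\<lambda>m. - a * (weight (a * q\<^sup>2) q m * basis (a * q\<^sup>2) q k m)) sums
      (- a * ((- (a * q\<^sup>2)) ^ k * q ^ (k * (k - 1))))"
    using Suc assms by (intro sums_mult) simp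
  moreover have "- a * ((- (a * q\<^sup>2)) ^ k * q ^ (k * (k - 1))) = (- a) ^ Suc k * q ^ (Suc k * (Suc k - 1))"
  proof -
    have "(- (a * q\<^sup>2)) ^ k = (- a) ^ k * q ^ (2 * k)"
      by (simp only: power_mult power_mult_distrib flip: mult_minus_left)
    moreover have "Suc k * (Suc k - 1) = 2 * k + k * (k - 1)"
      by (cases k) simp_all
    ultimately show ?thesis
      by (simp only: power_add power_Suc mult_ac)
  qed
  ultimately have "(\<lambda>m. weight a q (Suc m) * basis a q (Suc k) (Suc m)) sums
      ((- a) ^ Suc k * q ^ (Suc k * (Suc k - 1)))"
    by (simp only: weight_basis_Suc[OF assms(1,2) Suc.prems])
  \<comment> \<open>At m = 0 the first factor of (q^(-m);q)_(k+1) is 1 - 1, so the shift of m loses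
    no term.\<close>
  moreover have "weight a q 0 * basis a q (Suc k) 0 = 0"
    by (simp add: basis_def qpoch_Suc_shift)
  ultimately show ?case
    by (rule sums_Suc_imp[rotated])
qed

section \<open>Expansion of d_n in the basis and its mean\<close>

text \<open>The product over \<open>j\<close> is \<open>(q\<^sup>-\<^sup>n;q)\<^sub>k q\<^sup>n\<^sup>k\<close>, freed of negative powers.\<close>

definition dcoeff :: "real \<Rightarrow> real \<Rightarrow> nat \<Rightarrow> nat \<Rightarrow> real" where
  "dcoeff a q n k = (\<Prod>j<k. q ^ n - q ^ j) / qpoch q q k / q ^ (k * (k - 1)) * (- 1 / a) ^ k"

lemma dcoeff_0 [simp]: "dcoeff a q n 0 = 1"
  by (simp add: dcoeff_def)

lemma dcoeff_eq_0: "n < k \<Longrightarrow> dcoeff a q n k = 0"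
  by (auto simp: dcoeff_def)

lemma dcoeff_diag_nonzero:
  assumes "0 < q" "q < 1" "0 < a"
  shows "dcoeff a q n n \<noteq> 0"
proof -
  have "q ^ n \<noteq> q ^ j" if "j < n" for j
    using power_strict_decreasing[OF that assms(1,2)] by simp
  then show ?thesis
    using assms qpoch_q_pos[of q n] by (auto simp: dcoeff_def)
qed

lemma qpoch_q_power_neg:
  assumes "(q::real) \<noteq> 0"
  shows "qpoch (q powi (- int n)) q k * (q ^ n) ^ k = (\<Prod>j<k. q ^ n - q ^ j)"
proof -
  have "(1 - q powi (- int n) * q ^ j) * q ^ n = q ^ n - q ^ j" for j
    using assms by (simp add: power_int_minus field_simps)
  then have "(\<Prod>j<k. q ^ n - q ^ j) = (\<Prod>j<k. (1 - q powi (- int n) * q ^ j) * q ^ n)"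
    by simp
  then show ?thesis
    by (simp add: qpoch_def prod.distrib)
qed

text \<open>Any bound \<open>N\<close> above n is allowed, so that neighbouring d_n can be expanded
  over one common range.\<close>

lemma dual_alt_qCharlier_eq_sum:
  assumes "0 < q" "q < 1" "0 < a" "n < N"
  shows "dual_alt_qCharlier a q n m = (\<Sum>k<N. dcoeff a q n k * basis a q k m)"
proof -
  have "qpoch (q powi (- int m)) q k * qpoch (- a * q ^ m) q k * qpoch (q powi (- int n)) q k / qpoch q q k
        * ((- 1) ^ k * q ^ (k * (k - 1) div 2)) powi (- 2) * (- (q ^ n) / a) ^ k
      = dcoeff a q n k * basis a q k m" for k
  proof -
    have "((- 1) ^ k * q ^ (k * (k - 1) div 2)) powi (- 2) = 1 / ((- 1) ^ k * q ^ (k * (k - 1) div 2))\<^sup>2"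
      by (simp add: power_int_minus field_simps)
    \<comment> \<open>Squaring removes the sign and, k (k - 1) being even, undoes the
      \<open>div 2\<close>.\<close>
    also have "((- 1) ^ k * q ^ (k * (k - 1) div 2))\<^sup>2 = q ^ (k * (k - 1))"
    proof -
      have "even (k * (k - 1))"
        by (cases k) auto
      then have "k * (k - 1) div 2 * 2 = k * (k - 1)"
        by (rule dvd_div_mult_self)
      then have "(q ^ (k * (k - 1) div 2))\<^sup>2 = q ^ (k * (k - 1))"
        by (simp only: flip: power_mult)
      then show ?thesis
        by (simp add: power_mult_distrib flip: power_mult[of "-1"])
    qed
    finally have 1: "((- 1) ^ k * q ^ (k * (k - 1) div 2)) powi (- 2) = 1 / q ^ (k * (k - 1))" .
    have 3: "qpoch (q powi (- int n)) q k * (q ^ n) ^ k = (\<Prod>j<k. q ^ n - q ^ j)"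
      using assms by (intro qpoch_q_power_neg) simp
    have 2: "(- (q ^ n) / a) ^ k = (q ^ n) ^ k * (- 1 / a) ^ k"
      by (simp flip: power_mult_distrib)
    show ?thesis
      unfolding 1 2 dcoeff_def basis_def 3[symmetric]
      by (simp only: times_divide_eq_left times_divide_eq_right divide_divide_eq_left mult_1_left mult_1_right mult_ac)
  qed
  moreover have "(\<Sum>k. dcoeff a q n k * basis a q k m) = (\<Sum>k<N. dcoeff a q n k * basis a q k m)"
    using assms(4) by (intro suminf_finite) (auto simp: dcoeff_eq_0)
  ultimately show ?thesis
    unfolding dual_alt_qCharlier_def phi_3_0_def by simp
qed

text \<open>A q-binomial sum. Adding the next term to the closed form leaves the factor (1 -
  q^(N+1)) + (x - 1) = x - q^(N+1).\<close>

lemma sum_power_minus_prod_div_qpoch: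
  assumes "0 < q" "q < 1"
  shows "(\<Sum>k<Suc N. (\<Prod>j<k. x - q ^ j) / qpoch q q k) = (\<Prod>j<N. x - q ^ Suc j) / qpoch q q N"
proof (induction N)
  case (Suc N)
  have nz: "1 - q ^ Suc N \<noteq> 0" using power_Suc_less_one[OF assms, of N] by simp
  have "(\<Prod>j<Suc N. x - q ^ j) = (x - 1) * (\<Prod>j<N. x - q ^ Suc j)"
    by (subst prod.lessThan_Suc_shift) simp
  then have "(\<Sum>k<Suc (Suc N). (\<Prod>j<k. x - q ^ j) / qpoch q q k)
      = (\<Prod>j<N. x - q ^ Suc j) / qpoch q q N + (x - 1) * (\<Prod>j<N. x - q ^ Suc j) / (qpoch q q N * (1 - q ^ Suc N))"
    using Suc by (simp add: qpoch_Suc)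
  also have "\<dots> = (1 - q ^ Suc N + (x - 1)) * (\<Prod>j<N. x - q ^ Suc j) / (qpoch q q N * (1 - q ^ Suc N))"
  proof -
    have "A / Y + (x - 1) * A / (Y * D) = (D + (x - 1)) * A / (Y * D)" if "D \<noteq> 0" for A Y D :: real
      using that by (simp add: ring_distribs add_divide_distrib diff_divide_distrib)
    from this[OF nz] show ?thesis .
  qed
  finally show ?case by (simp add: qpoch_Suc mult_ac)
qed simp

lemma moment_dual_alt_qCharlier:
  assumes "0 < q" "q < 1" "0 < a"
  shows "(\<lambda>m. weight a q m * dual_alt_qCharlier a q n m) sums (if n = 0 then 1 else 0)"
proof -
  have "(\<lambda>m. \<Sum>k<Suc n. dcoeff a q n k * (weight a q m * basis a q k m)) sums
      (\<Sum>k<Suc n. dcoeff a q n k * ((- a) ^ k * q ^ (k * (k - 1))))"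
    by (rule sums_sum, rule sums_mult, rule moment_basis) (rule assms)+
  moreover have "(\<Sum>k<Suc n. dcoeff a q n k * (weight a q m * basis a q k m)) = weight a q m * dual_alt_qCharlier a q n m" for m
    unfolding dual_alt_qCharlier_eq_sum[OF assms lessI] sum_distrib_left by (simp only: mult_ac)
  moreover have "(\<Sum>k<Suc n. dcoeff a q n k * ((- a) ^ k * q ^ (k * (k - 1)))) = (if n = 0 then 1 else 0)"
  proof -
    \<comment> \<open>The powers of -a and of q in the moment cancel against those in
      \<open>dcoeff\<close>, leaving the q-binomial sum at x = q^n.\<close>
    have "dcoeff a q n k * ((- a) ^ k * q ^ (k * (k - 1))) = (\<Prod>j<k. q ^ n - q ^ j) / qpoch q q k" for k
    proof -
      have "(- 1 / a) ^ k * (- a) ^ k = 1"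
        using assms by (simp flip: power_mult_distrib)
      then show ?thesis
        using assms by (simp add: dcoeff_def)
    qed
    then have "(\<Sum>k<Suc n. dcoeff a q n k * ((- a) ^ k * q ^ (k * (k - 1)))) = (\<Prod>j<n. q ^ n - q ^ Suc j) / qpoch q q n"
      by (simp only: sum_power_minus_prod_div_qpoch[OF assms(1,2)])
    \<comment> \<open>For n > 0 the last factor, at j = n - 1, is q^n - q^n.\<close>
    also have "\<dots> = (if n = 0 then 1 else 0)"
      by (cases n) auto
    finally show ?thesis .
  qed
  ultimately show ?thesis by simp
qed

section \<open>The three-term recurrence in n\<close>

lemma prod_power_minus_Suc_Suc:
  fixes q :: "'a::comm_ring_1"
  shows "(\<Prod>j<Suc k. q ^ Suc n - q ^ j) = (q ^ Suc n - 1) * q ^ k * (\<Prod>j<k. q ^ n - q ^ j)"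
proof -
  have "q ^ Suc n - q ^ Suc j = q * (q ^ n - q ^ j)" for j
    by (simp add: right_diff_distrib)
  then have "(\<Prod>j<k. q ^ Suc n - q ^ Suc j) = q ^ k * (\<Prod>j<k. q ^ n - q ^ j)"
    by (simp only: prod.distrib prod_constant card_lessThan)
  then show ?thesis
    by (subst prod.lessThan_Suc_shift) (simp only: power_0 mult.assoc)
qed

text \<open>For \<open>n = 0\<close>, where \<open>n - 1\<close> is truncated to \<open>0\<close>, both sides vanish.\<close>

lemma prod_power_minus_pred:
  fixes q :: real
  assumes "q \<noteq> 0"
  shows "(1 - 1 / q ^ n) * (\<Prod>j<Suc k. q ^ (n - 1) - q ^ j)
    = (q ^ n / q - q ^ k) * (q ^ n - q ^ k) / (q ^ n * q ^ k) * (\<Prod>j<k. q ^ n - q ^ j)"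
proof (cases n)
  case 0
  then show ?thesis
    by (cases k) (auto simp: prod.lessThan_Suc_shift simp del: prod.lessThan_Suc)
next
  case (Suc r)
  define F where "F = (\<Prod>j<k. q ^ r - q ^ j)"
  define G where "G = (\<Prod>j<k. q ^ Suc r - q ^ j)"
  have eq: "G * (q ^ Suc r - q ^ k) = (q ^ Suc r - 1) * q ^ k * F"
    using prod_power_minus_Suc_Suc[of q r k] by (simp only: F_def G_def prod.lessThan_Suc)
  have "(1 - 1 / q ^ Suc r) * (F * (q ^ r - q ^ k))
      = (q ^ r - q ^ k) * ((q ^ Suc r - 1) * q ^ k * F) / (q ^ Suc r * q ^ k)"
    using assms by (simp add: field_simps)
  also have "\<dots> = (q ^ r - q ^ k) * (q ^ Suc r - q ^ k) / (q ^ Suc r * q ^ k) * G"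
    unfolding eq[symmetric] by (simp only: times_divide_eq_left times_divide_eq_right mult_ac)
  finally show ?thesis
    using assms by (simp add: Suc F_def G_def)
qed

text \<open>This compares the coefficients of \<open>basis\<close> at index k + 1 in the recurrence
  for mu d_n; the left side comes from \<open>mu_basis\<close>. After removal of the common factor F
  g it is a rational identity in Q = q^n and x = q^k.\<close>

lemma dcoeff_recurrence:
  assumes "0 < q" "q < 1" "0 < a"
  shows "dcoeff a q n (Suc k) * (1 / q ^ Suc k - a * q ^ Suc k) - dcoeff a q n k / q ^ k
    = - a * dcoeff a q (Suc n) (Suc k) + 1 / q ^ n * dcoeff a q n (Suc k)
      + (1 - 1 / q ^ n) * dcoeff a q (n - 1) (Suc k)"
proof -
  \<comment> \<open>\<open>g\<close> collects the factors of \<open>dcoeff\<close> at index k + 1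
    that do not involve the degree.\<close>
  define g where "g = (- 1 / a) ^ Suc k / (qpoch q q (Suc k) * q ^ (Suc k * k))"
  define F where "F = (\<Prod>j<k. q ^ n - q ^ j)"
  have c: "dcoeff a q i (Suc k) = (\<Prod>j<Suc k. q ^ i - q ^ j) * g" for i
    by (simp only: dcoeff_def g_def diff_Suc_1 divide_divide_eq_left times_divide_eq_left times_divide_eq_right mult_ac)
  have c1: "dcoeff a q n (Suc k) = (q ^ n - q ^ k) * F * g"
    unfolding c by (simp add: F_def)
  have c2: "dcoeff a q (Suc n) (Suc k) = (q * q ^ n - 1) * q ^ k * F * g"
    unfolding c prod_power_minus_Suc_Suc by (simp only: F_def power_Suc)
  have c3: "(1 - 1 / q ^ n) * dcoeff a q (n - 1) (Suc k)
      = (q ^ n / q - q ^ k) * (q ^ n - q ^ k) / (q ^ n * q ^ k) * F * g"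
    unfolding c F_def using prod_power_minus_pred[of q n k] assms by (simp only: mult.assoc[symmetric])
  have c0: "dcoeff a q n k = - a * (1 - q * q ^ k) * (q ^ k)\<^sup>2 * F * g"
  proof -
    define Y where "Y = qpoch q q k * q ^ (k * (k - 1))"
    have "1 - q * q ^ k \<noteq> 0" "q ^ k \<noteq> 0"
      using power_Suc_less_one[OF assms(1,2), of k] assms by simp_all
    moreover have "Suc k * k = 2 * k + k * (k - 1)"
      by (cases k) simp_all
    then have "q ^ (Suc k * k) = (q ^ k)\<^sup>2 * q ^ (k * (k - 1))"
      by (simp only: power_add power_mult[of q k 2] mult.commute[of 2])
    then have "g = - 1 / a * (- 1 / a) ^ k / ((1 - q * q ^ k) * (q ^ k)\<^sup>2 * Y)"
      by (simp only: g_def Y_def qpoch_Suc power_Suc mult_ac)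
    moreover have "- a * D * X * F * (- 1 / a * p / (D * X * Y)) = F * p / Y" if "D \<noteq> 0" "X \<noteq> 0" for D X p
      using that assms by simp
    ultimately show ?thesis
      by (simp add: dcoeff_def F_def Y_def)
  qed
  have "(Q - x) * F * g * (1 / (q * x) - a * (q * x)) - (- a * (1 - q * x) * x\<^sup>2 * F * g) / x
      = - a * ((q * Q - 1) * x * F * g) + 1 / Q * ((Q - x) * F * g) + (Q / q - x) * (Q - x) / (Q * x) * F * g"
    if "Q \<noteq> 0" "x \<noteq> 0" for Q x
    using that assms by (simp add: field_simps power2_eq_square)
  from this[of "q ^ n" "q ^ k"] show ?thesis
    unfolding c0 c1 c2 c3 power_Suc using assms by simp
qed

lemma mu_basis:
  assumes "q \<noteq> 0"
  shows "mu a q m * basis a q k m = (1 / q ^ k - a * q ^ k) * basis a q k m - basis a q (Suc k) m / q ^ k"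
proof -
  have "q ^ (2 * k) = q ^ k * q ^ k"
    by (simp only: mult_2 power_add)
  then show ?thesis
    using assms by (simp add: basis_Suc field_simps)
qed

lemma mu_dual_alt_qCharlier:
  assumes "0 < q" "q < 1" "0 < a"
  shows "mu a q m * dual_alt_qCharlier a q n m
    = - a * dual_alt_qCharlier a q (Suc n) m + 1 / q ^ n * dual_alt_qCharlier a q n m
      + (1 - 1 / q ^ n) * dual_alt_qCharlier a q (n - 1) m"
proof -
  let ?c = "dcoeff a q" and ?e = "\<lambda>k. basis a q k m"
  let ?M = "Suc n"
  \<comment> \<open>The term k = 0 is always 1; splitting it off indexes the remaining sum as in
    \<open>dcoeff_recurrence\<close>.\<close>
  have d: "dual_alt_qCharlier a q i m = 1 + (\<Sum>k<?M. ?c i (Suc k) * ?e (Suc k))" if "i < Suc ?M" for i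
    unfolding dual_alt_qCharlier_eq_sum[OF assms that] by (subst sum.lessThan_Suc_shift) simp
  have "mu a q m * dual_alt_qCharlier a q n m = (\<Sum>k<Suc ?M. ?c n k * (mu a q m * ?e k))"
    using dual_alt_qCharlier_eq_sum[OF assms, of n "Suc ?M" m] by (simp only: sum_distrib_left mult_ac)
  also have "\<dots> = (\<Sum>k<Suc ?M. ?c n k * (1 / q ^ k - a * q ^ k) * ?e k - ?c n k / q ^ k * ?e (Suc k))"
    using assms by (intro sum.cong refl) (simp add: mu_basis right_diff_distrib)
  also have "\<dots> = (\<Sum>k<Suc ?M. ?c n k * (1 / q ^ k - a * q ^ k) * ?e k) - (\<Sum>k<Suc ?M. ?c n k / q ^ k * ?e (Suc k))"
    by (rule sum_subtractf)
  also have "(\<Sum>k<Suc ?M. ?c n k * (1 / q ^ k - a * q ^ k) * ?e k)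
      = (1 - a) + (\<Sum>k<?M. ?c n (Suc k) * (1 / q ^ Suc k - a * q ^ Suc k) * ?e (Suc k))"
    by (subst sum.lessThan_Suc_shift) simp
  \<comment> \<open>The dropped term has k = n + 1, beyond the degree of d_n.\<close>
  also have "(\<Sum>k<Suc ?M. ?c n k / q ^ k * ?e (Suc k)) = (\<Sum>k<?M. ?c n k / q ^ k * ?e (Suc k))"
    by (subst sum.lessThan_Suc) (simp add: dcoeff_eq_0)
  also have "(1 - a) + (\<Sum>k<?M. ?c n (Suc k) * (1 / q ^ Suc k - a * q ^ Suc k) * ?e (Suc k))
        - (\<Sum>k<?M. ?c n k / q ^ k * ?e (Suc k))
      = (1 - a) + (\<Sum>k<?M. (?c n (Suc k) * (1 / q ^ Suc k - a * q ^ Suc k) - ?c n k / q ^ k) * ?e (Suc k))"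
    by (simp only: left_diff_distrib sum_subtractf add_diff_eq)
  also have "\<dots> = - a * dual_alt_qCharlier a q (Suc n) m + 1 / q ^ n * dual_alt_qCharlier a q n m
      + (1 - 1 / q ^ n) * dual_alt_qCharlier a q (n - 1) m"
  proof -
    have "(\<Sum>k<?M. (?c n (Suc k) * (1 / q ^ Suc k - a * q ^ Suc k) - ?c n k / q ^ k) * ?e (Suc k))
      = - a * (\<Sum>k<?M. ?c (Suc n) (Suc k) * ?e (Suc k)) + 1 / q ^ n * (\<Sum>k<?M. ?c n (Suc k) * ?e (Suc k))
        + (1 - 1 / q ^ n) * (\<Sum>k<?M. ?c (n - 1) (Suc k) * ?e (Suc k))"
      unfolding dcoeff_recurrence[OF assms]
      by (simp only: distrib_right sum.distrib sum_distrib_left mult.assoc)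
    \<comment> \<open>The coefficients -a, P and 1 - P add up to 1 - a, so the constant terms agree
      as well.\<close>
    moreover have "(1 - a) + (- a * A + P * B + (1 - P) * C) = - a * (1 + A) + P * (1 + B) + (1 - P) * (1 + C)"
      for A B C P
      by (simp add: algebra_simps)
    moreover have "n - 1 < Suc ?M" "n < Suc ?M" "Suc n < Suc ?M" by simp_all
    ultimately show ?thesis
      by (simp only: d)
  qed
  finally show ?thesis .
qed

section \<open>Norms and orthogonality\<close>

definition sqnorm :: "real \<Rightarrow> real \<Rightarrow> nat \<Rightarrow> real" where
  "sqnorm a q n = qpoch q q n / (a ^ n * q ^ (n * (n + 1) div 2))"

text \<open>The factor is written as the recurrence produces it in the orthogonality proof, where it
  settles the cases n = j + 1 and j = n + 1.\<close>

lemma sqnorm_Suc: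
  assumes "0 < q" "0 < a"
  shows "sqnorm a q (Suc n) = - (1 / a * (1 - 1 / q ^ Suc n) * sqnorm a q n)"
proof -
  have "Suc n * (Suc n + 1) = n * (n + 1) + Suc n * 2"
    by simp
  then have e: "Suc n * (Suc n + 1) div 2 = n * (n + 1) div 2 + Suc n"
    by simp
  have "- (1 / a * (1 - 1 / q ^ Suc n)) = (1 - q ^ Suc n) / (a * q ^ Suc n)"
    using assms by (simp add: field_simps)
  then have "- (1 / a * (1 - 1 / q ^ Suc n) * sqnorm a q n) = (1 - q ^ Suc n) / (a * q ^ Suc n) * sqnorm a q n"
    by (metis mult_minus_left)
  then show ?thesis
    unfolding sqnorm_def e by (simp add: qpoch_Suc power_add mult_ac)
qed

text \<open>The index n stays arbitrary in the induction on k, since the step from j to j + 1 also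
  uses d_(n+1) and d_(n-1).\<close>

lemma dual_alt_qCharlier_orthogonal:
  assumes "0 < q" "q < 1" "0 < a"
  shows "(\<lambda>m. weight a q m * dual_alt_qCharlier a q k m * dual_alt_qCharlier a q n m) sums
    (if k = n then sqnorm a q n else 0)"
proof (induction k arbitrary: n rule: less_induct)
  case (less k)
  show ?case
  proof (cases k)
    case 0
    moreover have "dual_alt_qCharlier a q 0 m = 1" for m
      using dual_alt_qCharlier_eq_sum[OF assms, of 0 1 m] by simp
    ultimately show ?thesis
      using moment_dual_alt_qCharlier[OF assms, of n] by (auto simp: sqnorm_def)
  next
    case (Suc j)
    let ?d = "dual_alt_qCharlier a q" and ?w = "weight a q" and ?h = "sqnorm a q"
    let ?s = "\<lambda>i l. if i = l then ?h l else 0"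
    have IH: "(\<lambda>m. ?w m * ?d i m * ?d l m) sums ?s i l" if "i \<le> j" for i l
      using less.IH[of i l] that Suc by simp
    have rec: "?w m * ?d (Suc j) m * ?d n m = ?w m * ?d j m * ?d (Suc n) m
        - 1 / a * (1 / q ^ n - 1 / q ^ j) * (?w m * ?d j m * ?d n m)
        - 1 / a * (1 - 1 / q ^ n) * (?w m * ?d j m * ?d (n - 1) m)
        + 1 / a * (1 - 1 / q ^ j) * (?w m * ?d (j - 1) m * ?d n m)" for m
    proof -
      \<comment> \<open>Here x belongs to n and y to j, with P = q^(-n) and R = q^(-j). Equating the
        two expressions for mu d_j d_n eliminates mu and isolates d_(j+1) d_n.\<close>
      have step: "w * y' * x = w * y * x' - 1 / a * (P - R) * (w * y * x)
          - 1 / a * (1 - P) * (w * y * x'') + 1 / a * (1 - R) * (w * y'' * x)"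
        if "\<mu> * x = - a * x' + P * x + (1 - P) * x''" "\<mu> * y = - a * y' + R * y + (1 - R) * y''"
        for \<mu> w x x' x'' y y' y'' P R
      proof -
        have y': "y' = (R * y + (1 - R) * y'' - \<mu> * y) / a" and x': "x' = (P * x + (1 - P) * x'' - \<mu> * x) / a"
          using that assms by (simp_all add: field_simps)
        show ?thesis
          unfolding x' y' using assms by (simp add: field_simps)
      qed
      show ?thesis
        by (rule step) (rule mu_dual_alt_qCharlier[OF assms])+
    qed
    have "(\<lambda>m. ?w m * ?d (Suc j) m * ?d n m) sums (?s j (Suc n)
        - 1 / a * (1 / q ^ n - 1 / q ^ j) * ?s j n
        - 1 / a * (1 - 1 / q ^ n) * ?s j (n - 1)
        + 1 / a * (1 - 1 / q ^ j) * ?s (j - 1) n)"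
      unfolding rec by (intro sums_add sums_diff sums_mult IH) simp_all
    also have "?s j (Suc n)
        - 1 / a * (1 / q ^ n - 1 / q ^ j) * ?s j n
        - 1 / a * (1 - 1 / q ^ n) * ?s j (n - 1)
        + 1 / a * (1 - 1 / q ^ j) * ?s (j - 1) n = ?s (Suc j) n"
    proof -
      consider "n = Suc j" | "j = Suc n" | "n = j" | "n \<noteq> Suc j" "j \<noteq> Suc n" "n \<noteq> j" by blast
      then show ?thesis
      proof cases
        case 1
        then show ?thesis using sqnorm_Suc[OF assms(1,3), of j] by simp
      next
        case 2
        then show ?thesis using sqnorm_Suc[OF assms(1,3), of n] by simp
      next
        case 3
        \<comment> \<open>The coefficient of the diagonal term is 0. For j = 0 the truncated
          predecessors coincide with j and n, but their coefficients 1 - 1/q^0 vanish.\<close>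
        then show ?thesis by (cases j) auto
      next
        case 4
        then have "j = n - 1 \<Longrightarrow> n = 0" "j - 1 = n \<Longrightarrow> j = 0" by linarith+
        with 4 show ?thesis by auto
      qed
    qed
    finally show ?thesis using Suc by simp
  qed
qed

section \<open>Polynomiality in mu(m)\<close>

definition basis_poly :: "real \<Rightarrow> real \<Rightarrow> nat \<Rightarrow> real poly" where
  "basis_poly a q k = (\<Prod>j<k. [:1 - a * q ^ (2 * j), - (q ^ j):])"

lemma poly_basis_poly:
  assumes "q \<noteq> 0"
  shows "poly (basis_poly a q k) (mu a q m) = basis a q k m"
  by (induction k) (use assms in \<open>simp_all add: basis_poly_def basis_Suc algebra_simps\<close>)

lemma degree_basis_poly:
  assumes "q \<noteq> 0"
  shows "degree (basis_poly a q k) = k"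
  using assms by (simp add: basis_poly_def degree_prod_eq_sum_degree)

text \<open>The linear factors in \<open>basis_Suc\<close> turn the expansion of d_n into a
  polynomial. Only its term k = n reaches degree n, and there both \<open>dcoeff\<close> and the
  leading coefficient of \<open>basis_poly\<close> are nonzero.\<close>

lemma dual_alt_qCharlier_polynomial:
  assumes "0 < q" "q < 1" "0 < a"
  shows "\<exists>p. degree p = n \<and> (\<forall>m. poly p (mu a q m) = dual_alt_qCharlier a q n m)"
proof (intro exI conjI allI)
  let ?p = "\<Sum>k<Suc n. smult (dcoeff a q n k) (basis_poly a q k)"
  have q: "q \<noteq> 0" using assms by simp
  show "degree ?p = n"
  proof (rule antisym)
    show "degree ?p \<le> n"
      by (intro degree_sum_le) (use degree_basis_poly[OF q] in \<open>auto intro: order.trans[OF degree_smult_le]\<close>)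
    have "(\<Sum>k<n. coeff (smult (dcoeff a q n k) (basis_poly a q k)) n) = 0"
      by (intro sum.neutral) (simp add: coeff_eq_0 degree_basis_poly[OF q])
    then have "coeff ?p n = dcoeff a q n n * coeff (basis_poly a q n) n"
      by (simp add: coeff_sum)
    moreover have "basis_poly a q n \<noteq> 0"
      by (simp add: basis_poly_def q)
    then have "coeff (basis_poly a q n) n \<noteq> 0"
      using leading_coeff_0_iff[of "basis_poly a q n"] by (simp only: degree_basis_poly[OF q]) simp
    ultimately show "n \<le> degree ?p"
      using dcoeff_diag_nonzero[OF assms, of n] by (intro le_degree) simp
  qed
  show "poly ?p (mu a q m) = dual_alt_qCharlier a q n m" for m
    by (simp only: poly_sum poly_smult poly_basis_poly[OF q] dual_alt_qCharlier_eq_sum[OF assms lessI])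
qed

theorem mainTheorem1:
  fixes a q :: real
  assumes "0 < q" and "q < 1" and "a > 0"
  shows "(\<forall>n. \<exists>p :: real poly. degree p = n \<and>
             (\<forall>m. poly p (mu a q m) = dual_alt_qCharlier a q n m)) \<and>
         (\<forall>n n'.
            (\<lambda>m. (1 + a * q ^ (2 * m)) * a ^ m / (qpoch_inf (- a * q ^ m) q * qpoch q q m)
                  * q ^ (m * (3 * m - 1) div 2)
                  * dual_alt_qCharlier a q n m * dual_alt_qCharlier a q n' m)
            sums (qpoch q q n / (a ^ n * q ^ (n * (n + 1) div 2)) * (if n = n' then 1 else 0)))"
proof (intro conjI allI)
  show "\<exists>p :: real poly. degree p = n \<and> (\<forall>m. poly p (mu a q m) = dual_alt_qCharlier a q n m)" for n
    using assms by (rule dual_alt_qCharlier_polynomial)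
  fix n n'
  have "(if n = n' then sqnorm a q n' else 0) = sqnorm a q n * (if n = n' then 1 else 0)"
    by simp
  then show "(\<lambda>m. (1 + a * q ^ (2 * m)) * a ^ m / (qpoch_inf (- a * q ^ m) q * qpoch q q m)
                  * q ^ (m * (3 * m - 1) div 2)
                  * dual_alt_qCharlier a q n m * dual_alt_qCharlier a q n' m)
            sums (qpoch q q n / (a ^ n * q ^ (n * (n + 1) div 2)) * (if n = n' then 1 else 0))"
    using dual_alt_qCharlier_orthogonal[OF assms, of n n']
    unfolding weight_def pent_def sqnorm_def by (simp only:)
qed
end
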